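(* Let $\mathcal{H}$ be an ABA-free hypergraph on a finite totally ordered vertex set $V$ such that every pair of hyperedges of $\mathcal{H}$ has a common vertex. Then there exists a set of at most two vertices of $V$ that intersects every hyperedge of $\mathcal{H}$.
   Context: A hypergraph $\mathcal{F}$ on a totally ordered finite vertex set $V$ (i.e., a family of subsets of $V$) is called ABA-free if there are no two hyperedges $A,B\in\mathcal{F}$ and three vertices $x<y<z$ such that $x,z\in A\setminus B$ and $y\in B\setminus A$. *)

theory Defs
  imports Main
begin

definition hypergraph_on :: "'a set \<Rightarrow> 'a set set \<Rightarrow> bool" where
  "hypergraph_on V \<F> \<longleftrightarrow> (\<forall>A\<in>\<F>. A \<subseteq> V)"

definition ABA_free :: "'a::linorder set \<Rightarrow> 'a set set \<Rightarrow> bool" where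
  "ABA_free V \<F> \<longleftrightarrow>
     \<not> (\<exists>A\<in>\<F>. \<exists>B\<in>\<F>. \<exists>x\<in>V. \<exists>y\<in>V. \<exists>z\<in>V.
           x < y \<and> y < z \<and> x \<in> A - B \<and> z \<in> A - B \<and> y \<in> B - A)"

(* The two hyperedges need not be distinct, so the empty set is not a hyperedge of a
   pairwise intersecting hypergraph; no vertex set could meet it. *)
definition pairwise_intersecting :: "'a set set \<Rightarrow> bool" where
  "pairwise_intersecting \<F> \<longleftrightarrow> (\<forall>A\<in>\<F>. \<forall>B\<in>\<F>. A \<inter> B \<noteq> {})"

end

theory Submission
  imports Defs
begin

text \<open>
  Call a vertex unskippable if every hyperedge avoiding it lies entirely on one side of it.
  Every nonempty hyperedge contains an unskippable vertex: a hyperedge can be shrunk one vertex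
  at a time, adding the shrunken hyperedges while preserving ABA-freeness, until a singleton is
  reached. Now let \<open>p\<close> be the smallest among the last unskippable vertices of the hyperedges,
  attained by \<open>A\<close>, and \<open>q\<close> the largest among the first ones, attained by \<open>B\<close>. A hyperedge that
  avoids both \<open>p\<close> and \<open>q\<close> has an unskippable vertex \<open>c\<close> with \<open>p < c < q\<close>. Then \<open>A\<close> lies to the
  left of \<open>c\<close> and \<open>B\<close> to its right, so they are disjoint.
\<close>

definition unskippable :: "'a::linorder set set \<Rightarrow> 'a \<Rightarrow> bool" where
  "unskippable \<F> v \<longleftrightarrow> (\<forall>A\<in>\<F>. v \<in> A \<or> A \<subseteq> {..<v} \<or> A \<subseteq> {v<..})"

lemma unskippable_mono: "unskippable \<G> v \<Longrightarrow> \<F> \<subseteq> \<G> \<Longrightarrow> unskippable \<F> v"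
  unfolding unskippable_def by blast

lemma ABA_freeD:
  assumes "hypergraph_on V \<F>" "ABA_free V \<F>" "A \<in> \<F>" "B \<in> \<F>"
    and "x < y" "y < z" "x \<in> A - B" "y \<in> B - A" "z \<in> A - B"
  shows False
  using assms unfolding ABA_free_def hypergraph_on_def by blast

text \<open>A hyperedge avoiding \<open>v\<close> with vertices on both sides of it would form the
  forbidden pattern with \<open>{v}\<close>.\<close>

lemma unskippable_if_singleton:
  assumes "hypergraph_on V \<F>" "ABA_free V \<F>" "{v} \<in> \<F>"
  shows "unskippable \<F> v"
  unfolding unskippable_def
proof
  fix B assume B: "B \<in> \<F>"
  show "v \<in> B \<or> B \<subseteq> {..<v} \<or> B \<subseteq> {v<..}"
  proof (rule ccontr)
    assume "\<not> ?thesis"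
    then obtain x z where "v \<notin> B" "x \<in> B" "\<not> x < v" "z \<in> B" "\<not> v < z"
      by auto
    moreover from this have "z < v" "v < x"
      by (metis linorder_neqE)+
    ultimately show False
      using ABA_freeD[OF assms(1,2) B assms(3), of z v x] by auto
  qed
qed

text \<open>
  Removing \<open>a\<close> from \<open>A\<close> destroys ABA-freeness only if some \<open>B\<close> containing \<open>a\<close> misses a vertex of
  \<open>A\<close> between \<open>a\<close> and a vertex of \<open>B - A\<close>, either to the left or to the right of \<open>a\<close>. The largest
  \<open>a\<close> that is not bad on the left is not bad on the right either.
\<close>

lemma ABA_free_insert_remove:
  fixes V :: "'a::linorder set"
  assumes H: "hypergraph_on V \<F>" and F: "ABA_free V \<F>" and A: "A \<in> \<F>"
    and fin: "finite A" and ne: "A \<noteq> {}"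
    and min: "\<And>B. B \<in> \<F> \<Longrightarrow> B \<subset> A \<Longrightarrow> B = {}"
  obtains a where "a \<in> A" "ABA_free V (insert (A - {a}) \<F>)"
proof -
  define L where "L a \<longleftrightarrow> (\<exists>B\<in>\<F>. a \<in> B \<and> (\<exists>x\<in>B - A. \<exists>y\<in>A - B. x < y \<and> y < a))" for a
  define R where "R a \<longleftrightarrow> (\<exists>B\<in>\<F>. a \<in> B \<and> (\<exists>w\<in>B - A. \<exists>y\<in>A - B. a < y \<and> y < w))" for a
  define a where "a = Max {a \<in> A. \<not> L a}"
  have "\<not> L (Min A)"
    unfolding L_def using Min_le[OF fin] by (auto simp: not_less)
  then have "{a \<in> A. \<not> L a} \<noteq> {}"
    using Min_in[OF fin ne] by auto
  then have a: "a \<in> A" "\<not> L a"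
    using Max_in[of "{a \<in> A. \<not> L a}"] fin unfolding a_def by auto
  have a_max: "L b" if "b \<in> A" "a < b" for b
    using Max_ge[of "{a \<in> A. \<not> L a}" b] fin that unfolding a_def by fastforce
  have "\<not> R a"
  proof
    assume "R a"
    then obtain C w y0 where C: "C \<in> \<F>" "a \<in> C" "w \<in> C - A" "y0 \<in> A - C" "a < y0" "y0 < w"
      unfolding R_def by auto
    \<comment> \<open>Taking the first such vertex after \<open>a\<close> forces every vertex of
      \<open>A\<close> in between to belong to \<open>C\<close>.\<close>
    define y where "y = Min {y \<in> A - C. a < y}"
    have "y \<in> {y \<in> A - C. a < y}"
      unfolding y_def by (rule Min_in) (use fin C in auto)
    then have y: "y \<in> A" "y \<notin> C" "a < y" by auto
    have y_le: "y \<le> z" if "z \<in> A - C" "a < z" for z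
      unfolding y_def by (rule Min_le) (use fin that in auto)
    have "y < w" using y_le[of y0] C by auto
    \<comment> \<open>As \<open>y\<close> lies beyond \<open>a\<close>, maximality of
      \<open>a\<close> makes \<open>y\<close> bad on the left.\<close>
    obtain B x b0 where B: "B \<in> \<F>" "y \<in> B" "x \<in> B - A" "b0 \<in> A - B" "x < b0" "b0 < y"
      using a_max[OF y(1,3)] unfolding L_def by auto
    \<comment> \<open>If \<open>b0 < a\<close>, then \<open>a \<in> B\<close> would make
      \<open>a\<close> bad on the left; so \<open>a\<close> itself serves as
      \<open>b\<close>.\<close>
    obtain b where b: "b \<in> A - B" "x < b" "b < y" "a \<le> b"
    proof (cases "a \<le> b0")
      case True
      with B that show ?thesis by auto
    next
      case False
      then have "b0 < a" by simp
      then have "a \<notin> B" using a(2) B unfolding L_def by blast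
      with a(1) \<open>b0 < a\<close> B(5) y(3) that[of a] show ?thesis by auto
    qed
    have "b \<in> C" using b y_le[of b] C(2) by (metis DiffD1 DiffI leD le_less)
    \<comment> \<open>Otherwise \<open>x\<close> and \<open>w\<close> in \<open>C - A\<close> would
      surround \<open>y\<close> in \<open>A - C\<close>. With \<open>x\<close> outside
      \<open>C\<close>, the vertices \<open>x < b < y\<close> form the pattern for \<open>B\<close>
      and \<open>C\<close>.\<close>
    moreover have "x \<notin> C"
      using ABA_freeD[OF H F C(1) A, of x y w] less_trans[OF b(2,3)] B(3) y C(3) \<open>y < w\<close> by auto
    ultimately show False
      using ABA_freeD[OF H F B(1) C(1), of x b y] B b y by auto
  qed
  have "ABA_free V (insert (A - {a}) \<F>)"
    unfolding ABA_free_def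
  proof clarify
    fix P Q x y z
    assume P: "P \<in> insert (A - {a}) \<F>" and Q: "Q \<in> insert (A - {a}) \<F>"
      and xyz: "x < y" "y < z" "x \<in> P" "x \<notin> Q" "z \<in> P" "z \<notin> Q" "y \<in> Q" "y \<notin> P"
    consider "P \<in> \<F>" "Q \<in> \<F>" | "P = A - {a}" "Q \<in> \<F>" | "P \<in> \<F>" "Q = A - {a}"
      using P Q xyz by auto
    then show False
    proof cases
      case 1
      then show ?thesis using ABA_freeD[OF H F, of P Q x y z] xyz by auto
    next
      case 2
      with xyz have xz: "x \<in> A - Q" "z \<in> A - Q" by auto
      have "y \<in> A"
        using ABA_freeD[OF H F A 2(2), of x y z] xyz xz by auto
      then have "y = a" using 2 xyz by auto
      \<comment> \<open>Minimality of \<open>A\<close> supplies a vertex \<open>v\<close> of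
        \<open>Q\<close> outside \<open>A\<close>. It cannot lie between \<open>x\<close> and
        \<open>z\<close>, so it makes \<open>a = y\<close> bad on the left or on the right.\<close>
      have "\<not> Q \<subset> A" using min[OF 2(2)] xyz by auto
      then obtain v where v: "v \<in> Q - A" using xz by auto
      have "v \<noteq> y" using v \<open>y \<in> A\<close> by auto
      moreover have "v \<noteq> x" "v \<noteq> z" using v xz by auto
      moreover have "\<not> (x < v \<and> v < z)"
        using ABA_freeD[OF H F A 2(2), of x v z] xz v by auto
      ultimately consider "v < x" | "z < v"
        by (metis linorder_neqE)
      then show ?thesis
      proof cases
        case 1
        then show ?thesis using a(2) v xz xyz 2(2) \<open>y = a\<close> unfolding L_def by blast
      next
        case 2
        then show ?thesis using \<open>\<not> R a\<close> v xz xyz \<open>Q \<in> \<F>\<close> \<open>y = a\<close> unfolding R_def by blast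
      qed
    next
      case 3
      with xyz have y: "y \<in> A - P" "y \<noteq> a" by auto
      \<comment> \<open>At most one of \<open>x\<close> and \<open>z\<close> can be the removed
        vertex; if neither is, the pattern was already present for \<open>P\<close> and
        \<open>A\<close>.\<close>
      consider "x = a" "z \<in> P - A" | "z = a" "x \<in> P - A" | "x \<in> P - A" "z \<in> P - A"
        using 3 xyz by auto
      then show ?thesis
      proof cases
        case 1
        then show ?thesis using \<open>\<not> R a\<close> y xyz 3(1) unfolding R_def by blast
      next
        case 2
        then show ?thesis using a(2) y xyz 3(1) unfolding L_def by blast
      next
        case 3
        then show ?thesis using ABA_freeD[OF H F \<open>P \<in> \<F>\<close> A, of x y z] y xyz by auto
      qed
    qed
  qed
  with a(1) that show thesis by blast
qed

text \<open>The induction varies the hypergraph along with \<open>A\<close>, since shrinking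
  \<open>A\<close> adds a hyperedge; a vertex unskippable for the larger hypergraph remains so for
  the original.\<close>

lemma ex_unskippable:
  fixes V :: "'a::linorder set"
  assumes "hypergraph_on V \<F>" "ABA_free V \<F>" "A \<in> \<F>" "finite A" "A \<noteq> {}"
  shows "\<exists>v\<in>A. unskippable \<F> v"
  using assms
proof (induction "card A" arbitrary: A \<F> rule: less_induct)
  case less
  show ?case
  proof (cases "\<exists>B\<in>\<F>. B \<subset> A \<and> B \<noteq> {}")
    case True
    then obtain B where B: "B \<in> \<F>" "B \<subset> A" "B \<noteq> {}" by blast
    then have "card B < card A" "finite B"
      using less.prems(4) by (auto intro: psubset_card_mono finite_subset)
    from less.hyps[OF this(1) less.prems(1,2) B(1) this(2) B(3)] B(2)
    show ?thesis by blast
  next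
    case False
    obtain a where a: "a \<in> A" "ABA_free V (insert (A - {a}) \<F>)"
      using ABA_free_insert_remove[OF less.prems] False by blast
    show ?thesis
    proof (cases "A = {a}")
      case True
      then show ?thesis
        using unskippable_if_singleton[OF less.prems(1,2), of a] less.prems(3) by auto
    next
      case False
      have "hypergraph_on V (insert (A - {a}) \<F>)"
        using less.prems(1,3) unfolding hypergraph_on_def by auto
      moreover have "card (A - {a}) < card A"
        using a(1) less.prems(4) by (rule card_Diff1_less[rotated])
      moreover have "A - {a} \<noteq> {}" using False a(1) by auto
      ultimately obtain v where "v \<in> A - {a}" "unskippable (insert (A - {a}) \<F>) v"
        using less.hyps[of "A - {a}" "insert (A - {a}) \<F>"] a(2) less.prems(4) by auto
      then show ?thesis using unskippable_mono by blast
    qed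
  qed
qed

theorem mainTheorem1:
  fixes V :: "'a::linorder set" and \<H> :: "'a set set"
  assumes "finite V"
    and "hypergraph_on V \<H>"
    and "ABA_free V \<H>"
    and "pairwise_intersecting \<H>"
  shows "\<exists>S. S \<subseteq> V \<and> card S \<le> 2 \<and> (\<forall>A\<in>\<H>. S \<inter> A \<noteq> {})"
proof (cases "\<H> = {}")
  case True
  then show ?thesis by (intro exI[of _ "{}"]) auto
next
  case False
  have sub: "A \<subseteq> V" if "A \<in> \<H>" for A
    using assms(2) that unfolding hypergraph_on_def by blast
  then have fin: "finite \<H>"
    using assms(1) by (meson Pow_iff finite_Pow_iff finite_subset subsetI)
  define U where "U A = {v \<in> A. unskippable \<H> v}" for A
  have finU: "finite (U A)" and neU: "U A \<noteq> {}" if "A \<in> \<H>" for A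
  proof -
    have "finite A" using sub[OF that] assms(1) finite_subset by blast
    then show "finite (U A)" unfolding U_def by simp
    have "A \<noteq> {}" using assms(4) that unfolding pairwise_intersecting_def by blast
    then show "U A \<noteq> {}"
      using ex_unskippable[OF assms(2,3) that \<open>finite A\<close>] unfolding U_def by blast
  qed
  define p where "p = Min ((\<lambda>A. Max (U A)) ` \<H>)"
  define q where "q = Max ((\<lambda>A. Min (U A)) ` \<H>)"
  have "p \<in> (\<lambda>A. Max (U A)) ` \<H>" "q \<in> (\<lambda>A. Min (U A)) ` \<H>"
    unfolding p_def q_def using fin False by (auto intro!: Min_in Max_in)
  then obtain A B where A: "A \<in> \<H>" "p = Max (U A)" and B: "B \<in> \<H>" "q = Min (U B)"
    by auto
  have pA: "p \<in> U A" and qB: "q \<in> U B"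
    using A B finU neU by auto
  have "{p, q} \<inter> C \<noteq> {}" if C: "C \<in> \<H>" for C
  proof
    assume "{p, q} \<inter> C = {}"
    then have pC: "p \<notin> C" and qC: "q \<notin> C" by auto
    have MC: "Max (U C) \<in> C" and mC: "Min (U C) \<in> U C"
      using Max_in[OF finU[OF C] neU[OF C]] Min_in[OF finU[OF C] neU[OF C]]
      unfolding U_def by auto
    have "p \<le> Max (U C)" "Min (U C) \<le> q"
      unfolding p_def q_def using fin C by auto
    \<comment> \<open>\<open>C\<close> has a vertex at or beyond \<open>p\<close> and one at or
      before \<open>q\<close>. Being unskippable and missed by \<open>C\<close>, \<open>p\<close>
      and \<open>q\<close> then have all of \<open>C\<close> strictly between them.\<close>
    then have "\<not> C \<subseteq> {..<p}" "\<not> C \<subseteq> {q<..}"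
      using MC mC by (auto simp: U_def subset_iff not_less[symmetric])
    then have "C \<subseteq> {p<..}" "C \<subseteq> {..<q}"
      using pA qB pC qC C unfolding U_def unskippable_def by blast+
    moreover obtain c where c: "c \<in> C" "unskippable \<H> c"
      using mC unfolding U_def by blast
    ultimately have "p < c" "c < q" by auto
    have "c \<notin> A"
    proof
      assume "c \<in> A"
      then have "c \<in> U A" using c(2) unfolding U_def by blast
      then show False using Max_ge[OF finU[OF A(1)]] A(2) \<open>p < c\<close> by fastforce
    qed
    \<comment> \<open>The vertex \<open>p\<close> of \<open>A\<close> decides on which side of
      \<open>c\<close> all of \<open>A\<close> lies.\<close>
    then have "A \<subseteq> {..<c}"
      using c(2) A(1) pA \<open>p < c\<close> unfolding unskippable_def U_def by force
    have "c \<notin> B"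
    proof
      assume "c \<in> B"
      then have "c \<in> U B" using c(2) unfolding U_def by blast
      then show False using Min_le[OF finU[OF B(1)]] B(2) \<open>c < q\<close> by fastforce
    qed
    then have "B \<subseteq> {c<..}"
      using c(2) B(1) qB \<open>c < q\<close> unfolding unskippable_def U_def by force
    with \<open>A \<subseteq> {..<c}\<close> have "A \<inter> B = {}" by fastforce
    then show False using assms(4) A(1) B(1) unfolding pairwise_intersecting_def by blast
  qed
  moreover have "{p, q} \<subseteq> V"
    using pA qB sub A(1) B(1) unfolding U_def by blast
  moreover have "card {p, q} \<le> 2"
    by (simp add: card_insert_if)
  ultimately show ?thesis by blast
qed

end
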